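(* Let $\gamma>0$, let $n\ge 1$ and let $X_1,\dots,X_n$ be i.i.d. random variables with the $\Gamma(\gamma)$ distribution. Let $\Phi\colon(0,+\infty)\to(0,+\infty)$ be a completely monotone function and let $c>0$. Then the function $$(a_1,\dots,a_n)\mapsto \mathbb{E}\,\Phi\left(c+\sum_{j=1}^n\sqrt{a_j}\,(X_j-\gamma)\right)$$ is Schur-concave on the set $\left\{a\in\mathbb{R}_+^n:\ \sum_{j=1}^n a_j<\frac{c^2}{\gamma^2 n}\right\}$.
   Context: The $\Gamma(\gamma)$ distribution is the distribution on $\mathbb{R}$ with density $\Gamma(\gamma)^{-1}x^{\gamma-1}e^{-x}\mathbf{1}_{(0,\infty)}(x)$; its mean is $\gamma$. A function $\Phi\colon(0,+\infty)\to(0,+\infty)$ is completely monotone if $\Phi(x)=\int_0^\infty e^{-tx}\,\mathrm{d}\mu(t)$ for all $x>0$, for some nonnegative Borel measure $\mu$ on $[0,\infty)$; equivalently, $(-1)^m\Phi^{(m)}(x)\ge 0$ for all $x>0$ and $m=0,1,2,\dots$. Here $\mathbb{R}_+=[0,\infty)$. A vector $a\in\mathbb{R}^n$ is majorised by $b\in\mathbb{R}^n$ if $\sum_j a_j=\sum_j b_j$ and, for each $k\le n$, the sum of the $k$ largest coordinates of $a$ is at most the sum of the $k$ largest coordinates of $b$. A function $F$ is Schur-concave (resp. Schur-convex) on a permutation-invariant set $D$ if $F(a)\ge F(b)$ (resp. $F(a)\le F(b)$) whenever $a,b\in D$ and $a$ is majorised by $b$. *)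

theory Defs
  imports "HOL-Probability.Probability"
begin

definition gamma_density :: "real \<Rightarrow> real \<Rightarrow> real" where
  "gamma_density g x = (if 0 < x then x powr (g - 1) * exp (- x) / Gamma g else 0)"

text \<open>
  The integral is taken in the extended nonnegative reals, so that the equation also forces it
  to be finite for every positive x; the measure itself may be infinite.
\<close>
definition completely_monotone :: "(real \<Rightarrow> real) \<Rightarrow> bool" where
  "completely_monotone \<Phi> \<longleftrightarrow>
    (\<exists>\<mu> :: real measure. sets \<mu> = sets (restrict_space borel {0..}) \<and>
      (\<forall>x>0. ennreal (\<Phi> x) = (\<integral>\<^sup>+ t. ennreal (exp (- t * x)) \<partial>\<mu>)))"

text \<open>
  Zero extension of a function that is only given on the positive half-line. The values of a
  total function at nonpositive arguments are arbitrary (possibly not even measurable); composing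
  with a random variable that is positive only almost surely must not depend on them.
\<close>
definition zero_ext :: "(real \<Rightarrow> real) \<Rightarrow> real \<Rightarrow> real" where
  "zero_ext \<Phi> x = (if 0 < x then \<Phi> x else 0)"

definition decreasing_coords :: "real ^ 'n \<Rightarrow> real list" where
  "decreasing_coords a =
    rev (sorted_list_of_multiset (image_mset (\<lambda>i. a $ i) (mset_set UNIV)))"

definition majorised_by :: "real ^ 'n \<Rightarrow> real ^ 'n \<Rightarrow> bool" where
  "majorised_by a b \<longleftrightarrow>
    (\<Sum>j\<in>UNIV. a $ j) = (\<Sum>j\<in>UNIV. b $ j) \<and>
    (\<forall>k\<le>CARD('n). sum_list (take k (decreasing_coords a))
                    \<le> sum_list (take k (decreasing_coords b)))"

definition permutation_invariant :: "(real ^ 'n) set \<Rightarrow> bool" where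
  "permutation_invariant D \<longleftrightarrow>
    (\<forall>p. p permutes UNIV \<longrightarrow> (\<forall>a\<in>D. (\<chi> i. a $ p i) \<in> D))"

definition schur_concave_on :: "(real ^ 'n) set \<Rightarrow> (real ^ 'n \<Rightarrow> real) \<Rightarrow> bool" where
  "schur_concave_on D F \<longleftrightarrow>
    permutation_invariant D \<and> (\<forall>a\<in>D. \<forall>b\<in>D. majorised_by a b \<longrightarrow> F b \<le> F a)"

end

theory Submission
  imports Defs
begin

text \<open>
  Write \<open>S\<^sub>a = c + \<Sum>\<^sub>j \<surd>a\<^sub>j (X\<^sub>j - \<gamma>)\<close>. A completely monotone function is a mixture of exponentials
  \<open>x \<mapsto> exp (-t x)\<close> with \<open>t \<ge> 0\<close>, so by Tonelli it is enough to compare \<open>E exp (-t S\<^sub>a)\<close> for each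
  fixed \<open>t\<close>. Independence and the Laplace transform \<open>(1 + s) powr (-\<gamma>)\<close> of the gamma distribution
  turn this expectation into
  \<open>exp (-t c + \<gamma> \<Sum>\<^sub>j (t \<surd>a\<^sub>j - ln (1 + t \<surd>a\<^sub>j)))\<close>.
  The function \<open>x \<mapsto> t \<surd>x - ln (1 + t \<surd>x)\<close> is concave on the nonnegative half-line, its derivative
  being \<open>t\<^sup>2 / (2 (1 + t \<surd>x))\<close>; hence the sum in the exponent is Schur-concave by Karamata's
  inequality, and so is the expectation.

  The bound on \<open>\<Sum>\<^sub>j a\<^sub>j\<close> gives, via Cauchy-Schwarz, \<open>\<gamma> \<Sum>\<^sub>j \<surd>a\<^sub>j < c\<close>. As the \<open>X\<^sub>j\<close> are positive almost
  surely, \<open>S\<^sub>a\<close> then stays above a positive constant. This has two uses: the mixture representation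
  applies at \<open>S\<^sub>a\<close>, and the expectation is finite, because \<open>\<Phi>\<close> is decreasing. Finiteness matters
  since the comparison is made between integrals in the extended nonnegative reals.
\<close>

section \<open>Karamata's inequality\<close>

text \<open>
  Abel summation: each inductive step may raise the weight of the nonnegative partial sum
  accumulated so far to the next weight.
\<close>
lemma sum_mono_weights_le:
  fixes w z :: "nat \<Rightarrow> real"
  assumes "\<And>k. k \<le> n \<Longrightarrow> 0 \<le> (\<Sum>i<k. z i)"
    and "\<And>i j. i \<le> j \<Longrightarrow> j < n \<Longrightarrow> w i \<le> w j"
  shows "(\<Sum>i<n. w i * z i) \<le> w (n - 1) * (\<Sum>i<n. z i)"
  using assms
proof (induction n)
  case 0
  then show ?case by simp
next
  case (Suc n)
  have "(\<Sum>i<n. w i * z i) \<le> w (n - 1) * (\<Sum>i<n. z i)"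
    using Suc by (meson le_SucI less_SucI)
  also have "\<dots> \<le> w n * (\<Sum>i<n. z i)"
    using Suc.prems(1)[of n] Suc.prems(2)[of "n - 1" n] by (intro mult_right_mono) auto
  finally show ?case by (simp add: algebra_simps)
qed

text \<open>
  The slopes \<open>d\<close> are supergradients of \<open>f\<close> on \<open>S\<close>, which is concavity in the form that
  Abel summation consumes; in particular they decrease along \<open>S\<close>.
\<close>
lemma karamata_list:
  fixes f d :: "real \<Rightarrow> real"
  assumes super: "\<And>x y. x \<in> S \<Longrightarrow> y \<in> S \<Longrightarrow> f y \<le> f x + d x * (y - x)"
    and len: "length xs = n" "length ys = n"
    and S: "set xs \<subseteq> S" "set ys \<subseteq> S"
    and desc: "sorted_wrt (\<ge>) xs"
    and prefix: "\<And>k. k \<le> n \<Longrightarrow> sum_list (take k xs) \<le> sum_list (take k ys)"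
    and total: "sum_list xs = sum_list ys"
  shows "sum_list (map f ys) \<le> sum_list (map f xs)"
proof -
  have anti: "d y \<le> d x" if "x \<in> S" "y \<in> S" "x \<le> y" for x y
  proof (cases "x = y")
    case False
    have "f y \<le> f x + d x * (y - x)" "f x \<le> f y + d y * (x - y)"
      using super that by auto
    then have "d y * (y - x) \<le> d x * (y - x)" by (simp add: algebra_simps)
    then show ?thesis using that False by auto
  qed simp
  have in_S: "xs ! i \<in> S" "ys ! i \<in> S" if "i < n" for i
    using S len that by (auto simp: subset_iff)
  have take_sum: "sum_list (take k zs) = (\<Sum>i<k. zs ! i)" if "k \<le> n" "length zs = n"
    for k and zs :: "real list"
    using that by (simp add: sum_list_sum_nth atLeast0LessThan)
  have partial: "0 \<le> (\<Sum>i<k. ys ! i - xs ! i)" if "k \<le> n" for k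
    using prefix[OF that] that len by (simp add: take_sum sum_subtractf)
  have slopes: "d (xs ! i) \<le> d (xs ! j)" if "i \<le> j" "j < n" for i j
  proof (cases "i = j")
    case False
    then show ?thesis
      using that len sorted_wrt_nth_less[OF desc, of i j] by (intro anti in_S) auto
  qed simp
  have "sum_list (map f ys) = (\<Sum>i<n. f (ys ! i))"
    using len by (simp add: sum_list_sum_nth atLeast0LessThan)
  also have "\<dots> \<le> (\<Sum>i<n. f (xs ! i) + d (xs ! i) * (ys ! i - xs ! i))"
    by (intro sum_mono super in_S) auto
  also have "\<dots> = (\<Sum>i<n. f (xs ! i)) + (\<Sum>i<n. d (xs ! i) * (ys ! i - xs ! i))"
    by (simp add: sum.distrib)
  also have "\<dots> \<le> (\<Sum>i<n. f (xs ! i))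
      + d (xs ! (n - 1)) * (\<Sum>i<n. ys ! i - xs ! i)"
    by (intro add_left_mono sum_mono_weights_le partial slopes)
  also have "(\<Sum>i<n. ys ! i - xs ! i) = 0"
    using total len by (simp add: sum_list_sum_nth atLeast0LessThan sum_subtractf)
  also have "(\<Sum>i<n. f (xs ! i)) + d (xs ! (n - 1)) * 0 = sum_list (map f xs)"
    using len by (simp add: sum_list_sum_nth atLeast0LessThan)
  finally show ?thesis .
qed

lemma mset_decreasing_coords:
  "mset (decreasing_coords a) = image_mset (\<lambda>i. a $ i) (mset_set UNIV)"
  unfolding decreasing_coords_def by simp

lemma set_decreasing_coords: "set (decreasing_coords a) = range (\<lambda>i. a $ i)"
  using arg_cong[OF mset_decreasing_coords, of set_mset a] by simp

lemma length_decreasing_coords: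
  fixes a :: "real ^ 'n"
  shows "length (decreasing_coords a) = CARD('n)"
  using arg_cong[OF mset_decreasing_coords, of size a] by simp

lemma sorted_decreasing_coords: "sorted_wrt (\<ge>) (decreasing_coords a)"
  unfolding decreasing_coords_def by (simp add: sorted_wrt_rev)

lemma sum_list_map_decreasing_coords:
  "sum_list (map f (decreasing_coords a)) = (\<Sum>j\<in>UNIV. f (a $ j))"
proof -
  have "sum_list (map f (decreasing_coords a)) = sum_mset (image_mset f (mset (decreasing_coords a)))"
    by (metis mset_map sum_mset_sum_list)
  then show ?thesis
    by (simp add: mset_decreasing_coords sum_unfold_sum_mset multiset.map_comp comp_def)
qed

lemma karamata_majorised:
  fixes f d :: "real \<Rightarrow> real" and a b :: "real ^ 'n"
  assumes "\<And>x y. x \<in> S \<Longrightarrow> y \<in> S \<Longrightarrow> f y \<le> f x + d x * (y - x)"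
    and "\<And>j. a $ j \<in> S" "\<And>j. b $ j \<in> S"
    and "majorised_by a b"
  shows "(\<Sum>j\<in>UNIV. f (b $ j)) \<le> (\<Sum>j\<in>UNIV. f (a $ j))"
proof -
  have "sum_list (map f (decreasing_coords b)) \<le> sum_list (map f (decreasing_coords a))"
  proof (rule karamata_list[where S = S and d = d and n = "CARD('n)"])
    show "sum_list (decreasing_coords a) = sum_list (decreasing_coords b)"
      using assms(4) sum_list_map_decreasing_coords[of "\<lambda>x. x" a]
        sum_list_map_decreasing_coords[of "\<lambda>x. x" b]
      by (simp add: majorised_by_def)
  qed (use assms in \<open>auto simp: length_decreasing_coords set_decreasing_coords
        sorted_decreasing_coords majorised_by_def\<close>)
  then show ?thesis by (simp add: sum_list_map_decreasing_coords)
qed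

section \<open>Concavity of the exponent\<close>

text \<open>
  The derivative in \<open>v\<close> of the difference \<open>v - ln (1 + v) - v\<^sup>2 / (2 (1 + u))\<close> is
  \<open>v (u - v) / ((1 + u) (1 + v))\<close>, so the difference is largest at \<open>v = u\<close>. With
  \<open>u = t \<surd>x\<close> and \<open>v = t \<surd>y\<close> this is the supergradient inequality at \<open>x\<close>; the substitution avoids
  differentiating the square root at \<open>0\<close>.
\<close>
lemma diff_ln_le_quadratic:
  fixes u v :: real
  assumes "0 \<le> u" "0 \<le> v"
  shows "v - ln (1 + v) \<le> u - ln (1 + u) + (v\<^sup>2 - u\<^sup>2) / (2 * (1 + u))"
proof -
  define p where "p v = v - ln (1 + v) - v\<^sup>2 / (2 * (1 + u))" for v
  have der: "(p has_real_derivative (x * (u - x) / ((1 + u) * (1 + x)))) (at x)" if "0 \<le> x" for x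
  proof -
    define k where "k = 1 / (2 * (1 + u))"
    have "p = (\<lambda>v. v - ln (1 + v) - k * v\<^sup>2)"
      by (simp add: p_def k_def fun_eq_iff)
    moreover have "((\<lambda>v. v - ln (1 + v) - k * v\<^sup>2)
        has_real_derivative (1 - 1 / (1 + x) - k * (2 * x))) (at x)"
      using that by (auto intro!: derivative_eq_intros)
    moreover have "k * (2 * x) = x / (1 + u)"
      using assms by (simp add: k_def field_simps)
    moreover have "1 - 1 / (1 + x) - x / (1 + u) = x * (u - x) / ((1 + u) * (1 + x))"
      using that assms by (simp add: divide_simps) (simp add: algebra_simps)
    ultimately show ?thesis by simp
  qed
  have "p v \<le> p u"
  proof (cases "v \<le> u")
    case True
    show ?thesis
    proof (rule DERIV_nonneg_imp_nondecreasing[where f = p])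
      fix x assume "v \<le> x" "x \<le> u"
      then show "\<exists>y. (p has_real_derivative y) (at x) \<and> 0 \<le> y"
        using assms by (intro exI[of _ "x * (u - x) / ((1 + u) * (1 + x))"] conjI der) auto
    qed (use True in auto)
  next
    case False
    show ?thesis
    proof (rule DERIV_nonpos_imp_nonincreasing[where f = p])
      fix x assume "u \<le> x" "x \<le> v"
      then show "\<exists>y. (p has_real_derivative y) (at x) \<and> y \<le> 0"
        using assms by (intro exI[of _ "x * (u - x) / ((1 + u) * (1 + x))"] conjI der)
          (auto intro!: divide_nonpos_nonneg mult_nonneg_nonpos)
    qed (use False in auto)
  qed
  then show ?thesis by (simp add: p_def diff_divide_distrib)
qed

lemma sqrt_diff_ln_supergradient:
  fixes t x y :: real
  assumes "0 \<le> t" "0 \<le> x" "0 \<le> y"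
  shows "t * sqrt y - ln (1 + t * sqrt y)
    \<le> t * sqrt x - ln (1 + t * sqrt x) + t\<^sup>2 / (2 * (1 + t * sqrt x)) * (y - x)"
  using diff_ln_le_quadratic[of "t * sqrt x" "t * sqrt y"] assms
  by (simp add: power_mult_distrib right_diff_distrib diff_divide_distrib)

section \<open>Laplace transforms\<close>

lemma gamma_density_measurable [measurable]: "gamma_density g \<in> borel_measurable borel"
  unfolding gamma_density_def [abs_def] by measurable

text \<open>
  Scaling Euler's integral for \<open>Gamma g\<close> by \<open>1 + s\<close> merges the factor \<open>exp (- s x)\<close> with the
  \<open>exp (- x)\<close> of the density. Working with nonnegative integrals makes integrability automatic.
\<close>
lemma nn_integral_gamma_density_exp:
  fixes g s :: real
  assumes "0 < g" "0 \<le> s"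
  shows "(\<integral>\<^sup>+ x. ennreal (gamma_density g x) * ennreal (exp (- s * x)) \<partial>lborel)
    = ennreal ((1 + s) powr (- g))"
proof -
  let ?k = "1 + s"
  have G: "0 < Gamma g" using assms by (simp add: Gamma_real_pos)
  define I where
    "I = (\<integral>\<^sup>+ x. ennreal (gamma_density g x) * ennreal (exp (- s * x)) \<partial>lborel)"
  have "ennreal (Gamma g)
      = (\<integral>\<^sup>+ x. ennreal (indicator {0..} x * x powr (g - 1) / exp x) \<partial>lborel)"
    by (rule Gamma_conv_nn_integral_real) fact
  also have "\<dots> = ennreal ?k *
      (\<integral>\<^sup>+ x. ennreal (indicator {0..} (?k * x) * (?k * x) powr (g - 1) / exp (?k * x)) \<partial>lborel)"
    using assms by (subst nn_integral_real_affine[where c = ?k and t = 0]) auto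
  also have "\<dots> = ennreal ?k * (\<integral>\<^sup>+ x. ennreal (?k powr (g - 1) * Gamma g) *
      (ennreal (gamma_density g x) * ennreal (exp (- s * x))) \<partial>lborel)"
  proof -
    have "ennreal (indicator {0..} (?k * x) * (?k * x) powr (g - 1) / exp (?k * x))
        = ennreal (?k powr (g - 1) * Gamma g) *
          (ennreal (gamma_density g x) * ennreal (exp (- s * x)))" for x
    proof (cases "0 < x")
      case True
      have "indicator {0..} (?k * x) * (?k * x) powr (g - 1) / exp (?k * x)
          = (?k powr (g - 1) * Gamma g) * (gamma_density g x * exp (- s * x))"
      proof -
        have pw: "(?k * x) powr (g - 1) = ?k powr (g - 1) * x powr (g - 1)"
          using assms True by (intro powr_mult)
        have ex: "exp (- x) * exp (- s * x) = 1 / exp (?k * x)"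
          by (simp add: exp_minus exp_add distrib_right field_simps)
        have ind: "indicator {0..} (?k * x) = (1::real)"
          using assms True by simp
        have cancel: "k * z * (q * e / z * e') = k * q * (e * e')" if "z \<noteq> 0"
          for k z q e e' :: real
          using that by simp
        show ?thesis
          unfolding gamma_density_def if_P[OF True] pw ind
            cancel[OF less_imp_neq[OF G, THEN not_sym]] ex
          by simp
      qed
      moreover have "0 \<le> gamma_density g x"
        using G True by (auto simp: gamma_density_def intro!: divide_nonneg_pos)
      moreover have "0 \<le> ?k powr (g - 1) * Gamma g" using G by (intro mult_nonneg_nonneg) auto
      ultimately show ?thesis by (simp only: ennreal_mult mult_nonneg_nonneg exp_ge_zero)
    next
      case False
      then show ?thesis
        using assms by (cases "x = 0") (auto simp: gamma_density_def indicator_def zero_le_mult_iff)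
    qed
    then show ?thesis by simp
  qed
  also have "\<dots> = ennreal ?k * (ennreal (?k powr (g - 1) * Gamma g) * I)"
    unfolding I_def by (subst nn_integral_cmult) auto
  also have "\<dots> = ennreal (?k powr g * Gamma g) * I"
  proof -
    have "?k * (?k powr (g - 1) * Gamma g) = ?k powr g * Gamma g"
      using assms by (simp add: powr_diff)
    moreover have "ennreal ?k * ennreal (?k powr (g - 1) * Gamma g)
        = ennreal (?k * (?k powr (g - 1) * Gamma g))"
      using assms by (intro ennreal_mult'[symmetric]) simp
    ultimately show ?thesis by (metis mult.assoc)
  qed
  finally have eq: "ennreal (?k powr g * Gamma g) * I = ennreal (Gamma g)" ..
  define B where "B = ?k powr g * Gamma g"
  have B: "0 < B" unfolding B_def using assms G by (intro mult_pos_pos) auto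
  have "ennreal (inverse B) * ennreal B = 1"
    using B by (simp add: ennreal_mult'[symmetric])
  then have "I = ennreal (inverse B) * (ennreal B * I)"
    by (metis mult.assoc mult_1)
  also have "\<dots> = ennreal (inverse B) * ennreal (Gamma g)"
    unfolding B_def eq ..
  also have "\<dots> = ennreal (inverse B * Gamma g)"
    using G by (intro ennreal_mult''[symmetric]) simp
  also have "inverse B * Gamma g = ?k powr (- g)"
    unfolding B_def powr_minus inverse_mult_distrib mult.assoc
      left_inverse[OF less_imp_neq[OF G, THEN not_sym]] by simp
  finally show ?thesis unfolding I_def .
qed

text \<open>
  By independence the expectation is a product over \<open>j\<close>. The centring of \<open>X\<^sub>j\<close> contributes
  \<open>exp (\<gamma> t \<surd>a\<^sub>j)\<close> and the transform of \<open>X\<^sub>j\<close> contributes \<open>exp (- \<gamma> ln (1 + t \<surd>a\<^sub>j))\<close>; together they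
  give the concave function of the previous section, evaluated at \<open>a\<^sub>j\<close>.
\<close>
lemma (in prob_space) laplace_transform_gamma_sum:
  fixes X :: "'n::finite \<Rightarrow> 'a \<Rightarrow> real" and a :: "real ^ 'n"
  assumes "0 < \<gamma>" "0 \<le> t"
    and indep: "indep_vars (\<lambda>_. borel) X UNIV"
    and dist: "\<And>j. distributed M lborel (X j) (\<lambda>x. ennreal (gamma_density \<gamma> x))"
    and a: "\<And>j. 0 \<le> a $ j"
  shows "(\<integral>\<^sup>+ \<omega>. ennreal (exp (- t * (c + (\<Sum>j\<in>UNIV. sqrt (a $ j) * (X j \<omega> - \<gamma>))))) \<partial>M)
    = ennreal (exp (- t * c + \<gamma> * (\<Sum>j\<in>UNIV. t * sqrt (a $ j) - ln (1 + t * sqrt (a $ j)))))"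
proof -
  have [measurable]: "X j \<in> borel_measurable M" for j
    using indep by (auto simp: indep_vars_def)
  let ?s = "\<lambda>j. t * sqrt (a $ j)"
  have s: "0 \<le> ?s j" for j using assms by simp
  define K where "K = exp (- t * c + \<gamma> * (\<Sum>j\<in>UNIV. ?s j))"
  have split: "exp (- t * (c + (\<Sum>j\<in>UNIV. sqrt (a $ j) * (X j \<omega> - \<gamma>))))
      = K * (\<Prod>j\<in>UNIV. exp (- ?s j * X j \<omega>))" for \<omega>
    unfolding K_def exp_sum[OF finite, symmetric] exp_add[symmetric]
    by (simp add: sum_distrib_left sum_subtractf sum_negf algebra_simps)
  have factor: "(\<integral>\<^sup>+ \<omega>. ennreal (exp (- ?s j * X j \<omega>)) \<partial>M) = ennreal ((1 + ?s j) powr (- \<gamma>))" for j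
  proof -
    have "(\<integral>\<^sup>+ x. ennreal (gamma_density \<gamma> x) * ennreal (exp (- ?s j * x)) \<partial>lborel)
        = (\<integral>\<^sup>+ \<omega>. ennreal (exp (- ?s j * X j \<omega>)) \<partial>M)"
      by (rule distributed_nn_integral[OF dist]) measurable
    then show ?thesis
      using nn_integral_gamma_density_exp[OF assms(1) s] by simp
  qed
  have "(\<integral>\<^sup>+ \<omega>. ennreal (exp (- t * (c + (\<Sum>j\<in>UNIV. sqrt (a $ j) * (X j \<omega> - \<gamma>))))) \<partial>M)
      = (\<integral>\<^sup>+ \<omega>. ennreal K * (\<Prod>j\<in>UNIV. ennreal (exp (- ?s j * X j \<omega>))) \<partial>M)"
    unfolding split by (simp add: ennreal_mult' K_def prod_ennreal prod_nonneg)
  also have "\<dots> = ennreal K * (\<integral>\<^sup>+ \<omega>. (\<Prod>j\<in>UNIV. ennreal (exp (- ?s j * X j \<omega>))) \<partial>M)"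
    by (intro nn_integral_cmult) measurable
  also have "(\<integral>\<^sup>+ \<omega>. (\<Prod>j\<in>UNIV. ennreal (exp (- ?s j * X j \<omega>))) \<partial>M)
      = (\<Prod>j\<in>UNIV. \<integral>\<^sup>+ \<omega>. ennreal (exp (- ?s j * X j \<omega>)) \<partial>M)"
    by (intro indep_vars_nn_integral indep_vars_compose2[OF indep]) auto
  also have "\<dots> = ennreal (\<Prod>j\<in>UNIV. (1 + ?s j) powr (- \<gamma>))"
    unfolding factor by (simp add: prod_ennreal)
  also have "ennreal K * \<dots> = ennreal (K * (\<Prod>j\<in>UNIV. (1 + ?s j) powr (- \<gamma>)))"
    by (simp add: ennreal_mult' K_def)
  also have "(\<Prod>j\<in>UNIV. (1 + ?s j) powr (- \<gamma>)) = exp (\<Sum>j\<in>UNIV. - \<gamma> * ln (1 + ?s j))"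
    unfolding exp_sum[OF finite]
  proof (rule prod.cong)
    fix j show "(1 + ?s j) powr (- \<gamma>) = exp (- \<gamma> * ln (1 + ?s j))"
      using s[of j] by (simp add: powr_def)
  qed simp
  also have "K * \<dots> = exp (- t * c + \<gamma> * (\<Sum>j\<in>UNIV. ?s j - ln (1 + ?s j)))"
    unfolding K_def exp_add[symmetric]
    by (simp add: sum_distrib_left sum_subtractf sum_negf algebra_simps)
  finally show ?thesis .
qed

section \<open>Mixtures of exponentials\<close>

text \<open>
  Bounded parts of the half-line have finite mass because \<open>exp (-t)\<close> is bounded below there. This
  is what makes Tonelli's theorem available for a mixing measure of infinite mass.
\<close>
lemma sigma_finite_mixing_measure:
  fixes \<mu> :: "real measure"
  assumes sets: "sets \<mu> = sets (restrict_space borel {0..})"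
    and fin: "(\<integral>\<^sup>+ t. ennreal (exp (- t)) \<partial>\<mu>) < \<infinity>"
  shows "sigma_finite_measure \<mu>"
proof
  have space: "space \<mu> = {0..}"
    using sets_eq_imp_space_eq[OF sets] by (simp add: space_restrict_space)
  have [measurable]: "(\<lambda>t. t) \<in> borel_measurable \<mu>"
    unfolding measurable_cong_sets[OF sets refl] by (rule measurable_restrict_space1) simp
  define A where "A n = {t \<in> space \<mu>. t \<le> real n}" for n :: nat
  have A [measurable]: "A n \<in> sets \<mu>" for n unfolding A_def by measurable
  have "emeasure \<mu> (A n) \<noteq> \<infinity>" for n
  proof -
    have "emeasure \<mu> (A n) = (\<integral>\<^sup>+ t. indicator (A n) t \<partial>\<mu>)" by simp
    also have "\<dots> \<le> (\<integral>\<^sup>+ t. ennreal (exp (real n)) * ennreal (exp (- t)) \<partial>\<mu>)"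
      by (intro nn_integral_mono)
        (auto simp: A_def indicator_def ennreal_mult'[symmetric] exp_add[symmetric])
    also have "\<dots> = ennreal (exp (real n)) * (\<integral>\<^sup>+ t. ennreal (exp (- t)) \<partial>\<mu>)"
      by (intro nn_integral_cmult) measurable
    also have "\<dots> < \<infinity>" using fin by (simp add: ennreal_mult_less_top)
    finally show ?thesis by simp
  qed
  moreover have "\<Union> (range A) = space \<mu>"
    by (auto simp: A_def) (meson real_arch_simple)
  ultimately show "\<exists>F. countable F \<and> F \<subseteq> sets \<mu> \<and> \<Union> F = space \<mu> \<and> (\<forall>a\<in>F. emeasure \<mu> a \<noteq> \<infinity>)"
    using A by (intro exI[of _ "range A"]) auto
qed

text \<open>
  The mixture representation determines \<open>\<Phi>\<close> on the positive half-line as a parameter integral of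
  a jointly measurable function.
\<close>
lemma zero_ext_measurable:
  fixes \<mu> :: "real measure"
  assumes sets: "sets \<mu> = sets (restrict_space borel {0..})"
    and sf: "sigma_finite_measure \<mu>"
    and rep: "\<And>x. x > 0 \<Longrightarrow> ennreal (\<Phi> x) = (\<integral>\<^sup>+ t. ennreal (exp (- t * x)) \<partial>\<mu>)"
    and pos: "\<And>x. x > 0 \<Longrightarrow> \<Phi> x > 0"
  shows "zero_ext \<Phi> \<in> borel_measurable borel"
proof -
  interpret sigma_finite_measure \<mu> by fact
  have [measurable]: "(\<lambda>t. t) \<in> borel_measurable \<mu>"
    unfolding measurable_cong_sets[OF sets refl] by (rule measurable_restrict_space1) simp
  have "zero_ext \<Phi> = (\<lambda>x. if 0 < x then enn2real (\<integral>\<^sup>+ t. ennreal (exp (- t * x)) \<partial>\<mu>) else 0)"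
  proof
    fix x
    have "enn2real (\<integral>\<^sup>+ t. ennreal (exp (- t * x)) \<partial>\<mu>) = \<Phi> x" if "0 < x"
      using pos[OF that] by (simp only: rep[OF that, symmetric] enn2real_ennreal less_imp_le)
    then show "zero_ext \<Phi> x
        = (if 0 < x then enn2real (\<integral>\<^sup>+ t. ennreal (exp (- t * x)) \<partial>\<mu>) else 0)"
      by (simp add: zero_ext_def)
  qed
  also have "\<dots> \<in> borel_measurable borel"
    by measurable
  finally show ?thesis .
qed

section \<open>The shifted gamma sum\<close>

text \<open>
  This is Cauchy-Schwarz for \<open>\<surd>a\<close> against the all-ones vector, and the place where the dimension
  in the bound on \<open>\<Sum>\<^sub>j a\<^sub>j\<close> comes from.
\<close>
lemma sum_sqrt_less:
  fixes a :: "real ^ 'n"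
  assumes "0 < \<gamma>" "0 < c" "\<And>j. 0 \<le> a $ j"
    and "(\<Sum>j\<in>UNIV. a $ j) < c\<^sup>2 / (\<gamma>\<^sup>2 * real CARD('n))"
  shows "\<gamma> * (\<Sum>j\<in>UNIV. sqrt (a $ j)) < c"
proof -
  have "(\<Sum>j\<in>UNIV. sqrt (a $ j))\<^sup>2 \<le> (\<Sum>j\<in>UNIV. (sqrt (a $ j))\<^sup>2) * real CARD('n)"
    by (rule sum_squared_le_sum_of_squares)
  also have "\<dots> = (\<Sum>j\<in>UNIV. a $ j) * real CARD('n)" using assms by simp
  finally have "(\<gamma> * (\<Sum>j\<in>UNIV. sqrt (a $ j)))\<^sup>2 \<le> \<gamma>\<^sup>2 * ((\<Sum>j\<in>UNIV. a $ j) * real CARD('n))"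
    unfolding power_mult_distrib by (intro mult_left_mono) auto
  also have "\<dots> < c\<^sup>2" using assms by (simp add: field_simps)
  finally show ?thesis using assms by (simp add: power2_less_imp_less)
qed

lemma (in prob_space) gamma_sum_lower_bound:
  fixes X :: "'n::finite \<Rightarrow> 'a \<Rightarrow> real" and a :: "real ^ 'n"
  assumes dist: "\<And>j. distributed M lborel (X j) (\<lambda>x. ennreal (gamma_density \<gamma> x))"
    and a: "\<And>j. 0 \<le> a $ j"
  shows "AE \<omega> in M. c - \<gamma> * (\<Sum>j\<in>UNIV. sqrt (a $ j))
    \<le> c + (\<Sum>j\<in>UNIV. sqrt (a $ j) * (X j \<omega> - \<gamma>))"
proof -
  have "AE \<omega> in M. 0 < X j \<omega>" for j
    by (subst distributed_AE2[OF dist]) (auto simp: gamma_density_def)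
  then have "AE \<omega> in M. \<forall>j. 0 < X j \<omega>"
    by (simp add: AE_all_countable)
  then show ?thesis
  proof eventually_elim
    case (elim \<omega>)
    have "0 \<le> (\<Sum>j\<in>UNIV. sqrt (a $ j) * X j \<omega>)"
      using elim a by (intro sum_nonneg) (simp add: less_imp_le)
    then show ?case
      by (simp add: sum_distrib_left sum_subtractf algebra_simps)
  qed
qed

text \<open>
  Tonelli's theorem applied to the mixture representation at the random point. The hypothesis
  \<open>\<gamma> \<Sum>\<^sub>j \<surd>a\<^sub>j < c\<close> makes this point almost surely positive, so the zero extension of \<open>\<Phi>\<close> may
  be replaced by the mixture.
\<close>
lemma (in prob_space) nn_integral_zero_ext_gamma_sum:
  fixes X :: "'n::finite \<Rightarrow> 'a \<Rightarrow> real" and a :: "real ^ 'n" and \<mu> :: "real measure"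
  assumes "0 < \<gamma>"
    and indep: "indep_vars (\<lambda>_. borel) X UNIV"
    and dist: "\<And>j. distributed M lborel (X j) (\<lambda>x. ennreal (gamma_density \<gamma> x))"
    and a: "\<And>j. 0 \<le> a $ j" "\<gamma> * (\<Sum>j\<in>UNIV. sqrt (a $ j)) < c"
    and sets: "sets \<mu> = sets (restrict_space borel {0..})"
    and sf: "sigma_finite_measure \<mu>"
    and rep: "\<And>x. x > 0 \<Longrightarrow> ennreal (\<Phi> x) = (\<integral>\<^sup>+ t. ennreal (exp (- t * x)) \<partial>\<mu>)"
  shows "(\<integral>\<^sup>+ \<omega>. ennreal (zero_ext \<Phi> (c + (\<Sum>j\<in>UNIV. sqrt (a $ j) * (X j \<omega> - \<gamma>)))) \<partial>M)
    = (\<integral>\<^sup>+ t. ennreal (exp (- t * c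
        + \<gamma> * (\<Sum>j\<in>UNIV. t * sqrt (a $ j) - ln (1 + t * sqrt (a $ j))))) \<partial>\<mu>)"
proof -
  interpret mu: sigma_finite_measure \<mu> by fact
  interpret pair: pair_sigma_finite M \<mu> ..
  have space: "space \<mu> = {0..}"
    using sets_eq_imp_space_eq[OF sets] by (simp add: space_restrict_space)
  have [measurable]: "X j \<in> borel_measurable M" for j
    using indep by (auto simp: indep_vars_def)
  have [measurable]: "(\<lambda>t. t) \<in> borel_measurable \<mu>"
    unfolding measurable_cong_sets[OF sets refl] by (rule measurable_restrict_space1) simp
  let ?S = "\<lambda>\<omega>. c + (\<Sum>j\<in>UNIV. sqrt (a $ j) * (X j \<omega> - \<gamma>))"
  have "(\<integral>\<^sup>+ \<omega>. ennreal (zero_ext \<Phi> (?S \<omega>)) \<partial>M)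
      = (\<integral>\<^sup>+ \<omega>. \<integral>\<^sup>+ t. ennreal (exp (- t * ?S \<omega>)) \<partial>\<mu> \<partial>M)"
  proof (rule nn_integral_cong_AE)
    show "AE \<omega> in M. ennreal (zero_ext \<Phi> (?S \<omega>)) = (\<integral>\<^sup>+ t. ennreal (exp (- t * ?S \<omega>)) \<partial>\<mu>)"
      using gamma_sum_lower_bound[where X = X and a = a and c = c, OF dist a(1)]
    proof eventually_elim
      case (elim \<omega>)
      then have "0 < ?S \<omega>" using a(2) by linarith
      then show ?case by (simp only: zero_ext_def if_True rep)
    qed
  qed
  also have "\<dots> = (\<integral>\<^sup>+ t. \<integral>\<^sup>+ \<omega>. ennreal (exp (- t * ?S \<omega>)) \<partial>M \<partial>\<mu>)"
    by (rule pair.Fubini'[symmetric]) measurable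
  also have "\<dots> = (\<integral>\<^sup>+ t. ennreal (exp (- t * c
        + \<gamma> * (\<Sum>j\<in>UNIV. t * sqrt (a $ j) - ln (1 + t * sqrt (a $ j))))) \<partial>\<mu>)"
    by (intro nn_integral_cong laplace_transform_gamma_sum[OF assms(1) _ indep dist a(1)])
      (simp add: space)
  finally show ?thesis .
qed

theorem theorem1:
  fixes \<gamma> c :: real
    and M :: "'a measure"
    and X :: "'n::finite \<Rightarrow> 'a \<Rightarrow> real"
    and \<Phi> :: "real \<Rightarrow> real"
  assumes "\<gamma> > 0"
    and "prob_space M"
    and "prob_space.indep_vars M (\<lambda>_. borel) X UNIV"
    and "\<And>j. distributed M lborel (X j) (\<lambda>x. ennreal (gamma_density \<gamma> x))"
    and "\<And>x. x > 0 \<Longrightarrow> \<Phi> x > 0"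
    and "completely_monotone \<Phi>"
    and "c > 0"
  shows "schur_concave_on
    {a :: real ^ 'n. (\<forall>j. 0 \<le> a $ j) \<and>
      (\<Sum>j\<in>UNIV. a $ j) < c\<^sup>2 / (\<gamma>\<^sup>2 * real CARD('n))}
    (\<lambda>a. \<integral>\<omega>. zero_ext \<Phi> (c + (\<Sum>j\<in>UNIV. sqrt (a $ j) * (X j \<omega> - \<gamma>))) \<partial>M)"
proof -
  interpret prob_space M by fact
  obtain \<mu> :: "real measure" where sets: "sets \<mu> = sets (restrict_space borel {0..})"
    and rep: "\<And>x. x > 0 \<Longrightarrow> ennreal (\<Phi> x) = (\<integral>\<^sup>+ t. ennreal (exp (- t * x)) \<partial>\<mu>)"
    using assms(6) unfolding completely_monotone_def by blast
  have space: "space \<mu> = {0..}"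
    using sets_eq_imp_space_eq[OF sets] by (simp add: space_restrict_space)
  have "(\<integral>\<^sup>+ t. ennreal (exp (- t)) \<partial>\<mu>) = ennreal (\<Phi> 1)"
    using rep[of 1] by simp
  then have sf: "sigma_finite_measure \<mu>"
    by (intro sigma_finite_mixing_measure[OF sets]) simp
  have [measurable]: "zero_ext \<Phi> \<in> borel_measurable borel"
    by (rule zero_ext_measurable[OF sets sf rep assms(5)])
  have [measurable]: "X j \<in> borel_measurable M" for j
    using assms(3) by (auto simp: indep_vars_def)
  have nonneg: "0 \<le> zero_ext \<Phi> x" for x
    using assms(5)[of x] by (auto simp: zero_ext_def less_imp_le)
  have decreasing: "\<Phi> y \<le> \<Phi> x" if "0 < x" "x \<le> y" for x y
  proof -
    have "ennreal (\<Phi> y) \<le> ennreal (\<Phi> x)"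
      using that by (simp only: rep less_le_trans[OF that])
        (intro nn_integral_mono, auto simp: space intro!: mult_left_mono)
    then show ?thesis using assms(5)[OF that(1)] by (simp add: ennreal_le_iff)
  qed
  define D where "D = {a :: real ^ 'n. (\<forall>j. 0 \<le> a $ j) \<and>
      (\<Sum>j\<in>UNIV. a $ j) < c\<^sup>2 / (\<gamma>\<^sup>2 * real CARD('n))}"
  define S where "S a \<omega> = c + (\<Sum>j\<in>UNIV. sqrt (a $ j) * (X j \<omega> - \<gamma>))" for a \<omega>
  define N where "N a = (\<integral>\<^sup>+ \<omega>. ennreal (zero_ext \<Phi> (S a \<omega>)) \<partial>M)" for a
  define E where "E t a = exp (- t * c
      + \<gamma> * (\<Sum>j\<in>UNIV. t * sqrt (a $ j) - ln (1 + t * sqrt (a $ j))))" for t and a :: "real ^ 'n"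
  have [measurable]: "S a \<in> borel_measurable M" for a
    unfolding S_def [abs_def] by measurable
  have D_nonneg: "0 \<le> a $ j" if "a \<in> D" for a j using that by (simp add: D_def)
  have D_less: "\<gamma> * (\<Sum>j\<in>UNIV. sqrt (a $ j)) < c" if "a \<in> D" for a
    using that by (intro sum_sqrt_less assms) (auto simp: D_def)
  have N_eq: "N a = (\<integral>\<^sup>+ t. ennreal (E t a) \<partial>\<mu>)" if "a \<in> D" for a
    unfolding N_def S_def E_def
    by (rule nn_integral_zero_ext_gamma_sum[OF assms(1,3,4) D_nonneg[OF that] D_less[OF that]
          sets sf rep])
  have N_finite: "N a < \<infinity>" if "a \<in> D" for a
  proof -
    define \<delta> where "\<delta> = c - \<gamma> * (\<Sum>j\<in>UNIV. sqrt (a $ j))"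
    have \<delta>: "0 < \<delta>" using D_less[OF that] by (simp add: \<delta>_def)
    have "N a \<le> (\<integral>\<^sup>+ \<omega>. ennreal (\<Phi> \<delta>) \<partial>M)"
      unfolding N_def
    proof (rule nn_integral_mono_AE)
      show "AE \<omega> in M. ennreal (zero_ext \<Phi> (S a \<omega>)) \<le> ennreal (\<Phi> \<delta>)"
        using gamma_sum_lower_bound[where X = X and a = a and c = c, OF assms(4) D_nonneg[OF that]]
      proof eventually_elim
        case (elim \<omega>)
        then have "\<delta> \<le> S a \<omega>" by (simp add: \<delta>_def S_def)
        then show ?case using \<delta> by (auto simp: zero_ext_def intro!: ennreal_leI decreasing)
      qed
    qed
    also have "\<dots> < \<infinity>" by (simp add: emeasure_space_1)
    finally show ?thesis .
  qed
  have integral_eq: "(\<integral>\<omega>. zero_ext \<Phi> (S a \<omega>) \<partial>M) = enn2real (N a)" for a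
    unfolding N_def by (rule integral_eq_nn_integral) (auto simp: nonneg)
  have E_mono: "E t b \<le> E t a" if "a \<in> D" "b \<in> D" "majorised_by a b" "0 \<le> t" for a b t
  proof -
    have "(\<Sum>j\<in>UNIV. t * sqrt (b $ j) - ln (1 + t * sqrt (b $ j)))
        \<le> (\<Sum>j\<in>UNIV. t * sqrt (a $ j) - ln (1 + t * sqrt (a $ j)))"
      by (rule karamata_majorised[where S = "{0..}" and a = a and b = b
            and d = "\<lambda>x. t\<^sup>2 / (2 * (1 + t * sqrt x))"])
        (use that D_nonneg sqrt_diff_ln_supergradient[OF that(4)] in auto)
    then show ?thesis using assms(1) by (simp add: E_def)
  qed
  have "permutation_invariant D"
    unfolding permutation_invariant_def
  proof (intro allI impI ballI)
    fix p :: "'n \<Rightarrow> 'n" and a assume p: "p permutes UNIV" and "a \<in> D"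
    then show "(\<chi> i. a $ p i) \<in> D"
      using sum.permute[OF p, of "\<lambda>i. a $ i"] by (simp add: D_def comp_def)
  qed
  moreover have "(\<integral>\<omega>. zero_ext \<Phi> (S b \<omega>) \<partial>M) \<le> (\<integral>\<omega>. zero_ext \<Phi> (S a \<omega>) \<partial>M)"
    if "a \<in> D" "b \<in> D" "majorised_by a b" for a b
  proof -
    have "N b \<le> N a"
      unfolding N_eq[OF that(1)] N_eq[OF that(2)]
      by (intro nn_integral_mono ennreal_leI E_mono that) (simp add: space)
    then show ?thesis
      unfolding integral_eq using N_finite[OF that(1)] by (intro enn2real_mono) auto
  qed
  ultimately show ?thesis
    unfolding schur_concave_on_def D_def S_def by blast
qed

end
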